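(* Let $n\ge 1$ and $P\in D_n$. The number of returns of $P$ is $\|\mathcal{F}_{\sim P}\|+1$.
   Context: A Dyck path of semilength $n$ is a lattice path from $(0,0)$ to $(2n,0)$ using steps $u=(1,1)$ and $d=(1,-1)$ and never going below the $x$-axis. A return is a point of the path, other than the starting one, lying on the $x$-axis. $D_n$ is the set of Dyck paths of semilength $n$, ordered by $P\le Q$ iff $P$ lies weakly below $Q$; it is a finite distributive lattice with minimum $0=(ud)^n$, hence a Heyting algebra, with pseudocomplement $\sim\! P=\bigvee\{Z\in D_n : P\wedge Z=0\}$. Put $[n-1]=\{1,\ldots,n-1\}$. The join-irreducible elements of $D_n$ (other than the minimum) are the paths $J_{[a,b]}=(ud)^{a-1}u^{b-a+2}d^{b-a+2}(ud)^{n-1-b}$ for nonempty intervals $[a,b]=\{a,\ldots,b\}$ of $[n-1]$; the atoms are the $J_{[i,i]}$ ($J_{[i,i]}$ is the atom of order $i$), and the atoms below $J_{[a,b]}$ are those of orders in $[a,b]$. For $P\in D_n$, $\mathcal{F}_P$ denotes the antichain (with respect to inclusion) of intervals of $[n-1]$ representing $P$: it consists of the intervals $I$ such that $J_I$ occurs in the irredundant decomposition of $P$ as a join of join-irreducibles, i.e. the inclusion-maximal intervals $I$ with $J_I\le P$. If $\mathcal{F}_P=\{I_1,\ldots,I_m\}$, then $\|\mathcal{F}_P\|=|I_1\cup\cdots\cup I_m|$. *)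

theory Defs
  imports "HOL-Algebra.Lattice"
begin

datatype step = Up | Down

primrec step_height :: "step \<Rightarrow> int" where
  "step_height Up = 1"
| "step_height Down = - 1"

(* ordinate of the point with abscissa i of the path with step word w *)
definition height :: "step list \<Rightarrow> nat \<Rightarrow> int" where
  "height w i = (\<Sum>s\<leftarrow>take i w. step_height s)"

definition dyck_paths :: "nat \<Rightarrow> step list set" where
  "dyck_paths n = {w. length w = 2 * n \<and> height w (2 * n) = 0 \<and> (\<forall>i\<le>2 * n. height w i \<ge> 0)}"

definition dyck_order :: "nat \<Rightarrow> step list gorder" where
  "dyck_order n = \<lparr>carrier = dyck_paths n, eq = (=),
     le = (\<lambda>P Q. \<forall>i\<le>2 * n. height P i \<le> height Q i)\<rparr>"

definition ud_power :: "nat \<Rightarrow> step list" where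
  "ud_power k = concat (replicate k [Up, Down])"

(* the minimum of the order is ud_power n; the meet and the supremum are those of HOL-Algebra *)
definition pseudocomplement :: "nat \<Rightarrow> step list \<Rightarrow> step list" where
  "pseudocomplement n P =
     \<Squnion>\<^bsub>dyck_order n\<^esub> {Z \<in> dyck_paths n. P \<sqinter>\<^bsub>dyck_order n\<^esub> Z = ud_power n}"

(* the points of abscissa i > 0 on the x-axis, given by their abscissae *)
definition returns :: "step list \<Rightarrow> nat set" where
  "returns w = {i. 1 \<le> i \<and> i \<le> length w \<and> height w i = 0}"

(* J_[a,b] = (ud)^(a-1) u^(b-a+2) d^(b-a+2) (ud)^(n-1-b);
   only meaningful for 1 \<le> a \<le> b < n, where no subtraction truncates *)
definition join_irr :: "nat \<Rightarrow> nat \<Rightarrow> nat \<Rightarrow> step list" where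
  "join_irr n a b = ud_power (a - 1) @ replicate (b - a + 2) Up @ replicate (b - a + 2) Down
     @ ud_power (n - 1 - b)"

definition intervals_below :: "nat \<Rightarrow> step list \<Rightarrow> nat set set" where
  "intervals_below n P =
     {{a..b} | a b. 1 \<le> a \<and> a \<le> b \<and> b \<le> n - 1 \<and> join_irr n a b \<sqsubseteq>\<^bsub>dyck_order n\<^esub> P}"

(* the inclusion-maximal intervals below P: those whose join-irreducibles form the irredundant
   decomposition of P as a join *)
definition interval_antichain :: "nat \<Rightarrow> step list \<Rightarrow> nat set set" where
  "interval_antichain n P =
     {I \<in> intervals_below n P. \<forall>I' \<in> intervals_below n P. I \<subseteq> I' \<longrightarrow> I = I'}"

definition antichain_norm :: "nat set set \<Rightarrow> nat" where
  "antichain_norm F = card (\<Union>F)"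

end

theory Submission
  imports Defs
begin

text \<open>Parity of heights makes the pointwise maximum and minimum of Dyck paths again Dyck paths, so
  joins and meets in \<open>D\<^sub>n\<close> are computed pointwise on heights. Hence a path \<open>Z\<close> with \<open>P \<and> Z = 0\<close> can
  leave the axis at abscissa \<open>2i\<close> only where \<open>P\<close> touches it; conversely, where \<open>P\<close> touches the
  axis, the atom of order \<open>i\<close> is such a \<open>Z\<close>. So the pseudocomplement is above the axis at \<open>2i\<close>
  (\<open>0 < i < n\<close>) exactly where \<open>P\<close> has a return, and these \<open>i\<close> are the points covered by the
  antichain of the pseudocomplement.\<close>

section \<open>Heights of step words\<close>

lemma height_0 [simp]: "height w 0 = 0"
  by (simp add: height_def)

lemma height_Nil [simp]: "height [] k = 0"
  by (simp add: height_def)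

lemma height_Suc: "i < length w \<Longrightarrow> height w (Suc i) = height w i + step_height (w ! i)"
  by (simp add: height_def take_Suc_conv_app_nth)

text \<open>No case split is needed: up to the end of \<open>u\<close> the truncated difference is
  0, and past it \<open>take\<close> saturates, leaving the full height of \<open>u\<close>.\<close>

lemma height_append: "height (u @ v) k = height u k + height v (k - length u)"
  by (simp add: height_def)

lemma height_replicate: "height (replicate m s) k = int (min k m) * step_height s"
  by (simp add: height_def take_replicate sum_list_replicate)

lemma abs_step_height [simp]: "\<bar>step_height s\<bar> = 1"
  by (cases s) auto

text \<open>Every step changes both height and abscissa by an odd amount.\<close>

lemma even_height: "i \<le> length w \<Longrightarrow> even (height w i - int i)"
proof (induction i)
  case (Suc i)
  then show ?case
    by (cases "w ! i") (auto simp: height_Suc)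
qed simp

lemma height_inject:
  assumes "length u = length v" "\<And>i. i \<le> length u \<Longrightarrow> height u i = height v i"
  shows "u = v"
proof (rule nth_equalityI)
  fix i assume i: "i < length u"
  have "step_height (u ! i) = step_height (v ! i)"
    using assms(2)[of i] assms(2)[of "Suc i"] i assms(1) by (simp add: height_Suc)
  then show "u ! i = v ! i"
    by (cases "u ! i"; cases "v ! i") auto
qed (rule assms(1))

lemma length_ud_power [simp]: "length (ud_power m) = 2 * m"
  by (induction m) (auto simp: ud_power_def)

text \<open>Past its end a word keeps its final height, here 0. This value occurs when the word is a
  prefix of a longer one.\<close>

lemma height_ud_power: "height (ud_power m) k = (if k \<le> 2 * m then int (k mod 2) else 0)"
proof (induction m arbitrary: k)
  case 0
  then show ?case by (simp add: ud_power_def)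
next
  case (Suc m)
  have "height (ud_power (Suc m)) k = height [Up, Down] k + height (ud_power m) (k - Suc (Suc 0))"
    using height_append[of "[Up, Down]" "ud_power m" k] by (simp add: ud_power_def)
  moreover have "k = 0 \<or> k = 1 \<or> (\<exists>j. k = Suc (Suc j))"
    by presburger
  ultimately show ?case
    using Suc.IH by (auto simp: height_def)
qed

section \<open>Dyck paths and their height functions\<close>

lemma dyck_pathsD:
  assumes "P \<in> dyck_paths n"
  shows "length P = 2 * n" "height P (2 * n) = 0" "i \<le> 2 * n \<Longrightarrow> height P i \<ge> 0"
  using assms by (auto simp: dyck_paths_def)

text \<open>A nonnegative odd height is at least 1. The lower bound is the height of
  \<open>ud_power n\<close>, so this makes that path the minimum.\<close>

lemma height_dyck_ge: "P \<in> dyck_paths n \<Longrightarrow> i \<le> 2 * n \<Longrightarrow> int (i mod 2) \<le> height P i"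
  using even_height[of i P] dyck_pathsD(1)[of P n] dyck_pathsD(3)[of P n i] by presburger

lemma ud_power_dyck: "ud_power n \<in> dyck_paths n"
  by (auto simp: dyck_paths_def height_ud_power)

lemma finite_dyck_paths: "finite (dyck_paths n)"
proof -
  have "(UNIV :: step set) = {Up, Down}"
    using step.exhaust by auto
  then have "finite (UNIV :: step set)"
    by (metis finite.emptyI finite.insertI)
  then have "finite {w :: step list. set w \<subseteq> UNIV \<and> length w = 2 * n}"
    by (rule finite_lists_length_eq)
  then show ?thesis
    by (rule rev_finite_subset) (auto simp: dyck_paths_def)
qed

text \<open>Turns a pointwise maximum or minimum into a path: \<open>sel\<close> transfers parity,
  sign and end values from genuine paths, and parity together with \<open>lip\<close> forces every
  increment to be 1 or -1.\<close>

lemma dyck_path_of_heights: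
  fixes h :: "nat \<Rightarrow> int"
  assumes sel: "\<And>i. i \<le> 2 * n \<Longrightarrow> \<exists>Z\<in>dyck_paths n. h i = height Z i"
    and lip: "\<And>i. i < 2 * n \<Longrightarrow> \<bar>h (Suc i) - h i\<bar> \<le> 1"
  obtains S where "S \<in> dyck_paths n" "\<And>i. i \<le> 2 * n \<Longrightarrow> height S i = h i"
proof -
  define S where "S = map (\<lambda>i. if h (Suc i) > h i then Up else Down) [0..<2 * n]"
  have par: "even (h i - int i)" if "i \<le> 2 * n" for i
    using sel[OF that] even_height dyck_pathsD(1) that by metis
  have len: "length S = 2 * n"
    by (simp add: S_def)
  have S: "i \<le> 2 * n \<Longrightarrow> height S i = h i" for i
  proof (induction i)
    case 0
    then show ?case using sel[of 0] by auto
  next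
    case (Suc i)
    have "\<bar>h (Suc i) - h i\<bar> \<le> 1" "even (h i - int i)" "even (h (Suc i) - int (Suc i))"
      using Suc.prems lip[of i] par[of i] par[of "Suc i"] by auto
    then have "h (Suc i) = h i + 1 \<or> h (Suc i) = h i - 1"
      by presburger
    then show ?case
      using Suc by (auto simp: height_Suc len) (auto simp: S_def)
  qed
  have "h i \<ge> 0" if "i \<le> 2 * n" for i
    using sel[OF that] dyck_pathsD(3) that by fastforce
  moreover have "h (2 * n) = 0"
    using sel[of "2 * n"] dyck_pathsD(2) by fastforce
  ultimately have "S \<in> dyck_paths n"
    by (simp add: dyck_paths_def len S)
  then show thesis
    using S that by blast
qed

lemma height_dyck_lip: "P \<in> dyck_paths n \<Longrightarrow> i < 2 * n \<Longrightarrow> \<bar>height P (Suc i) - height P i\<bar> = 1"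
  by (simp add: height_Suc dyck_pathsD)

section \<open>The order on Dyck paths, its joins and meets\<close>

lemma dyck_order_simps [simp]:
  "carrier (dyck_order n) = dyck_paths n"
  "P \<sqsubseteq>\<^bsub>dyck_order n\<^esub> Q \<longleftrightarrow> (\<forall>i\<le>2 * n. height P i \<le> height Q i)"
  "P .=\<^bsub>dyck_order n\<^esub> Q \<longleftrightarrow> P = Q"
  by (auto simp: dyck_order_def)

lemma dyck_partial_order: "partial_order (dyck_order n)"
proof unfold_locales
  fix x y
  assume "x \<sqsubseteq>\<^bsub>dyck_order n\<^esub> y" "y \<sqsubseteq>\<^bsub>dyck_order n\<^esub> x"
    "x \<in> carrier (dyck_order n)" "y \<in> carrier (dyck_order n)"
  then show "x .=\<^bsub>dyck_order n\<^esub> y"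
    by (auto intro!: height_inject order.antisym simp: dyck_pathsD(1))
qed (auto intro: order.trans simp: dyck_order_def)

lemma height_dyck_sup:
  assumes A: "A \<subseteq> dyck_paths n" "A \<noteq> {}" and i: "i \<le> 2 * n"
  shows "\<Squnion>\<^bsub>dyck_order n\<^esub> A \<in> dyck_paths n"
    and "height (\<Squnion>\<^bsub>dyck_order n\<^esub> A) i = Max ((\<lambda>Z. height Z i) ` A)"
proof -
  define M where "M i = Max ((\<lambda>Z. height Z i) ` A)" for i
  have fin: "finite A"
    using A finite_dyck_paths finite_subset by blast
  have ge: "height Z i \<le> M i" if "Z \<in> A" for Z i
    unfolding M_def using fin that by simp
  have sel: "\<exists>Z\<in>A. M i = height Z i" for i
    using Max_in[of "(\<lambda>Z. height Z i) ` A"] fin A(2) unfolding M_def by blast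
  \<comment> \<open>A path attaining the maximum at one of the two abscissae is bounded by
    \<open>M\<close> at the other, a single step away; this applies in both directions.\<close>
  have lip: "\<bar>M (Suc i) - M i\<bar> \<le> 1" if i: "i < 2 * n" for i
  proof -
    obtain Y Z where "Y \<in> A" "M i = height Y i" "Z \<in> A" "M (Suc i) = height Z (Suc i)"
      using sel by blast
    moreover from this have "\<bar>height Y (Suc i) - height Y i\<bar> = 1" "\<bar>height Z (Suc i) - height Z i\<bar> = 1"
      using height_dyck_lip i A(1) by blast+
    ultimately show ?thesis
      using ge[of Y "Suc i"] ge[of Z i] by linarith
  qed
  obtain S where S: "S \<in> dyck_paths n" "\<And>i. i \<le> 2 * n \<Longrightarrow> height S i = M i"
    using dyck_path_of_heights[of n M] sel lip A(1) by blast
  have "least (dyck_order n) S (Upper (dyck_order n) A)"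
  proof (rule least_UpperI)
    fix y assume y: "y \<in> Upper (dyck_order n) A"
    show "S \<sqsubseteq>\<^bsub>dyck_order n\<^esub> y"
      unfolding dyck_order_simps
    proof (intro allI impI)
      fix k assume k: "k \<le> 2 * n"
      obtain Z where "Z \<in> A" "M k = height Z k"
        using sel by blast
      then show "height S k \<le> height y k"
        using y A(1) k by (auto simp: Upper_def S)
    qed
  qed (use S ge A in auto)
  \<comment> \<open>\<open>sup\<close> is a choice among least upper bounds; antisymmetry leaves
    \<open>S\<close> as the only candidate.\<close>
  then have "\<Squnion>\<^bsub>dyck_order n\<^esub> A = S"
    unfolding Lattice.sup_def
    by (intro some_equality partial_order.least_unique[OF dyck_partial_order])
  then show "\<Squnion>\<^bsub>dyck_order n\<^esub> A \<in> dyck_paths n"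
    "height (\<Squnion>\<^bsub>dyck_order n\<^esub> A) i = Max ((\<lambda>Z. height Z i) ` A)"
    using S i by (simp_all add: M_def)
qed

lemma height_dyck_meet:
  assumes P: "P \<in> dyck_paths n" and Q: "Q \<in> dyck_paths n" and i: "i \<le> 2 * n"
  shows "P \<sqinter>\<^bsub>dyck_order n\<^esub> Q \<in> dyck_paths n"
    and "height (P \<sqinter>\<^bsub>dyck_order n\<^esub> Q) i = min (height P i) (height Q i)"
proof -
  define h where "h i = min (height P i) (height Q i)" for i
  have sel: "\<exists>Z\<in>dyck_paths n. h i = height Z i" for i
    using P Q by (auto simp: h_def min_def)
  have lip: "\<bar>h (Suc i) - h i\<bar> \<le> 1" if i: "i < 2 * n" for i
    using height_dyck_lip[OF P i] height_dyck_lip[OF Q i] by (auto simp: h_def)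
  obtain S where S: "S \<in> dyck_paths n" "\<And>i. i \<le> 2 * n \<Longrightarrow> height S i = h i"
    using dyck_path_of_heights[of n h] sel lip by blast
  have "greatest (dyck_order n) S (Lower (dyck_order n) {P, Q})"
    by (rule greatest_LowerI) (use S P Q in \<open>auto simp: h_def Lower_def\<close>)
  then have "P \<sqinter>\<^bsub>dyck_order n\<^esub> Q = S"
    unfolding Lattice.meet_def Lattice.inf_def
    by (intro some_equality partial_order.greatest_unique[OF dyck_partial_order])
  then show "P \<sqinter>\<^bsub>dyck_order n\<^esub> Q \<in> dyck_paths n"
    "height (P \<sqinter>\<^bsub>dyck_order n\<^esub> Q) i = min (height P i) (height Q i)"
    using S i by (simp_all add: h_def)
qed

text \<open>Paths of equal length are determined by their heights, and \<open>int (k mod 2)\<close>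
  is the height of the minimum at \<open>k\<close>.\<close>

lemma dyck_meet_eq_bot_iff:
  assumes "P \<in> dyck_paths n" "Q \<in> dyck_paths n"
  shows "P \<sqinter>\<^bsub>dyck_order n\<^esub> Q = ud_power n \<longleftrightarrow>
    (\<forall>k\<le>2 * n. min (height P k) (height Q k) = int (k mod 2))" (is "?l \<longleftrightarrow> ?r")
proof
  assume ?l
  then show ?r
    using height_dyck_meet(2)[OF assms] by (simp add: height_ud_power)
next
  assume ?r
  then show ?l
    using height_dyck_meet[OF assms] dyck_pathsD(1)[OF height_dyck_meet(1)[OF assms order.refl]]
    by (intro height_inject) (auto simp: height_ud_power)
qed

section \<open>Heights of join-irreducibles and atoms\<close>

lemma height_join_irr:
  "height (join_irr n a b) k = height (ud_power (a - 1)) k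
     + int (min (k - 2 * (a - 1)) (b - a + 2))
     - int (min (k - 2 * (a - 1) - (b - a + 2)) (b - a + 2))
     + height (ud_power (n - 1 - b)) (k - 2 * (a - 1) - (b - a + 2) - (b - a + 2))"
  unfolding join_irr_def height_append height_replicate length_replicate length_ud_power by simp

text \<open>The pyramid of \<open>join_irr n a b\<close> spans the abscissae from
  \<open>2 * (a - 1)\<close> to \<open>2 * (b + 1)\<close>, so \<open>2 * i\<close> is strictly
  inside it.\<close>

lemma height_join_irr_pos:
  assumes "1 \<le> a" "a \<le> i" "i \<le> b" "b \<le> n - 1"
  shows "height (join_irr n a b) (2 * i) > 0"
proof -
  obtain c where a: "a = Suc c" using assms(1) by (cases a) auto
  obtain d where i: "i = Suc c + d" using assms(2) a le_Suc_ex by blast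
  obtain e where b: "b = Suc c + d + e" using assms(3) i le_Suc_ex by blast
  show ?thesis
    by (simp add: height_join_irr height_ud_power a i b min_def) linarith
qed

lemma height_atom:
  assumes "1 \<le> i" "i \<le> n - 1" "k \<le> 2 * n"
  shows "height (join_irr n i i) k = (if k = 2 * i then 2 else int (k mod 2))"
proof -
  obtain j where j: "i = Suc j" using assms(1) by (cases i) auto
  \<comment> \<open>The pyramid of the atom occupies \<open>2 * j\<close> to
    \<open>2 * j + 4\<close>: the cases are the part before it, its three interior points, and the
    part after.\<close>
  consider "k \<le> 2 * j" | "k = 2 * j + 1" | "k = 2 * j + 2" | "k = 2 * j + 3" | "k \<ge> 2 * j + 4"
    by linarith
  then show ?thesis
  proof cases
    case 5
    then obtain m where m: "k = 2 * j + 4 + m" using le_Suc_ex by blast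
    then have "m \<le> 2 * (n - 1 - i)" using assms j by simp
    moreover have "k mod 2 = m mod 2" unfolding m by presburger
    ultimately show ?thesis
      by (simp add: height_join_irr height_ud_power j m)
  qed (simp_all add: height_join_irr height_ud_power j)
qed

lemma atom_dyck:
  assumes "1 \<le> i" "i \<le> n - 1"
  shows "join_irr n i i \<in> dyck_paths n"
proof -
  have "length (join_irr n i i) = 2 * n"
    using assms by (auto simp: join_irr_def)
  then show ?thesis
    using assms by (auto simp: dyck_paths_def height_atom)
qed

section \<open>The points covered by the antichain\<close>

lemma Union_interval_antichain: "\<Union> (interval_antichain n Q) = \<Union> (intervals_below n Q)"
proof (intro equalityI subsetI)
  fix x assume "x \<in> \<Union> (intervals_below n Q)"
  then obtain I where I: "I \<in> intervals_below n Q" "x \<in> I" by blast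
  \<comment> \<open>Finiteness lets every interval below \<open>Q\<close> extend to a maximal
    one.\<close>
  have "finite (intervals_below n Q)"
    by (rule finite_subset[of _ "Pow {..n}"]) (auto simp: intervals_below_def)
  then obtain M where "M \<in> intervals_below n Q" "I \<subseteq> M"
    "\<forall>I' \<in> intervals_below n Q. M \<subseteq> I' \<longrightarrow> M = I'"
    using finite_has_maximal2[of "intervals_below n Q" I] I(1) by blast
  then show "x \<in> \<Union> (interval_antichain n Q)"
    using I(2) by (auto simp: interval_antichain_def)
qed (auto simp: interval_antichain_def)

lemma Union_intervals_below:
  assumes Q: "Q \<in> dyck_paths n"
  shows "\<Union> (intervals_below n Q) = {i. 1 \<le> i \<and> i \<le> n - 1 \<and> height Q (2 * i) > 0}"
proof (intro equalityI subsetI)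
  fix i assume "i \<in> \<Union> (intervals_below n Q)"
  then obtain a b where ab: "1 \<le> a" "a \<le> i" "i \<le> b" "b \<le> n - 1"
    and le: "\<forall>k\<le>2 * n. height (join_irr n a b) k \<le> height Q k"
    by (auto simp: intervals_below_def)
  from ab have "2 * i \<le> 2 * n" by simp
  with le have "height (join_irr n a b) (2 * i) \<le> height Q (2 * i)" by blast
  then show "i \<in> {i. 1 \<le> i \<and> i \<le> n - 1 \<and> height Q (2 * i) > 0}"
    using height_join_irr_pos[OF ab] ab by simp
next
  fix i assume "i \<in> {i. 1 \<le> i \<and> i \<le> n - 1 \<and> height Q (2 * i) > 0}"
  then have i: "1 \<le> i" "i \<le> n - 1" "height Q (2 * i) > 0" by auto
  \<comment> \<open>A positive even height is at least 2, the peak of the atom; elsewhere the atom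
    has the heights of the minimum.\<close>
  have "even (height Q (2 * i) - int (2 * i))"
    using even_height[of "2 * i" Q] dyck_pathsD(1)[OF Q] i by simp
  then have "height Q (2 * i) \<ge> 2"
    using i(3) by presburger
  then have "\<forall>k\<le>2 * n. height (join_irr n i i) k \<le> height Q k"
    using height_dyck_ge[OF Q] i by (auto simp: height_atom)
  then have "{i..i} \<in> intervals_below n Q"
    using i unfolding intervals_below_def dyck_order_simps by blast
  then show "i \<in> \<Union> (intervals_below n Q)" by auto
qed

section \<open>Pseudocomplement and returns\<close>

lemma height_pseudocomplement_pos_iff:
  assumes P: "P \<in> dyck_paths n" and i: "1 \<le> i" "i \<le> n - 1"
  shows "height (pseudocomplement n P) (2 * i) > 0 \<longleftrightarrow> height P (2 * i) = 0"
proof -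
  let ?A = "{Z \<in> dyck_paths n. P \<sqinter>\<^bsub>dyck_order n\<^esub> Z = ud_power n}"
  have i2: "2 * i \<le> 2 * n" using i by simp
  \<comment> \<open>The minimum as a member makes \<open>Max\<close> over this family
    meaningful.\<close>
  have ne: "ud_power n \<in> ?A"
    using P height_dyck_ge[OF P]
    by (simp add: ud_power_dyck dyck_meet_eq_bot_iff height_ud_power min_def) force
  have "height (pseudocomplement n P) (2 * i) = Max ((\<lambda>Z. height Z (2 * i)) ` ?A)"
    unfolding pseudocomplement_def using ne i2 by (intro height_dyck_sup(2)) auto
  also have "\<dots> > 0 \<longleftrightarrow> (\<exists>Z\<in>?A. height Z (2 * i) > 0)"
    using ne finite_dyck_paths by (subst Max_gr_iff) auto
  also have "\<dots> \<longleftrightarrow> height P (2 * i) = 0"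
  proof
    assume "\<exists>Z\<in>?A. height Z (2 * i) > 0"
    then obtain Z where Z: "Z \<in> dyck_paths n" "P \<sqinter>\<^bsub>dyck_order n\<^esub> Z = ud_power n"
      "height Z (2 * i) > 0" by auto
    \<comment> \<open>The right side is 0, so where \<open>Z\<close> is positive \<open>P\<close>
      has to vanish.\<close>
    have "min (height P (2 * i)) (height Z (2 * i)) = int ((2 * i) mod 2)"
      using Z(2) i2 dyck_meet_eq_bot_iff[OF P Z(1)] by blast
    then show "height P (2 * i) = 0"
      using Z(3) by (auto simp: min_def split: if_splits)
  next
    assume "height P (2 * i) = 0"
    \<comment> \<open>Off \<open>2 * i\<close> the atom agrees with the minimum, which lies below
      \<open>P\<close>; at \<open>2 * i\<close> the zero of \<open>P\<close> makes the meet
      vanish.\<close>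
    then have "join_irr n i i \<in> ?A"
      using i P height_dyck_ge[OF P]
      by (auto simp: atom_dyck dyck_meet_eq_bot_iff height_atom min_def intro: order.antisym)
    then show "\<exists>Z\<in>?A. height Z (2 * i) > 0"
      using height_atom[OF i i2] by force
  qed
  finally show ?thesis .
qed

text \<open>Returns have even abscissa by parity. The end point is split off to account for the
  summand 1 in the count; \<open>n \<ge> 1\<close> separates it from the starting point.\<close>

lemma returns_eq:
  assumes P: "P \<in> dyck_paths n" and n: "n \<ge> 1"
  shows "returns P = insert (2 * n) ((*) 2 ` {i. 1 \<le> i \<and> i \<le> n - 1 \<and> height P (2 * i) = 0})"
    (is "_ = ?R")
proof (intro equalityI subsetI)
  fix k assume "k \<in> returns P"
  then have k: "1 \<le> k" "k \<le> 2 * n" "height P k = 0"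
    using dyck_pathsD(1)[OF P] by (auto simp: returns_def)
  have "even k"
    using even_height[of k P] dyck_pathsD(1)[OF P] k by simp
  then obtain j where "k = 2 * j" by blast
  then show "k \<in> ?R"
    using k by (cases "j = n") auto
next
  fix k assume "k \<in> ?R"
  then show "k \<in> returns P"
    using dyck_pathsD(1,2)[OF P] n by (auto simp: returns_def)
qed

theorem proposition5p3:
  fixes n :: nat and P :: "step list"
  assumes "n \<ge> 1" and "P \<in> dyck_paths n"
  shows "card (returns P) = antichain_norm (interval_antichain n (pseudocomplement n P)) + 1"
proof -
  let ?Z = "{i. 1 \<le> i \<and> i \<le> n - 1 \<and> height P (2 * i) = 0}"
  \<comment> \<open>Shows that the family joined in the pseudocomplement is nonempty, as
    \<open>height_dyck_sup\<close> demands.\<close>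
  have "P \<sqinter>\<^bsub>dyck_order n\<^esub> ud_power n = ud_power n"
    using assms height_dyck_ge[of P n]
    by (simp add: ud_power_dyck dyck_meet_eq_bot_iff height_ud_power min_def) force
  then have "pseudocomplement n P \<in> dyck_paths n"
    unfolding pseudocomplement_def
    using ud_power_dyck by (intro height_dyck_sup(1)[where i = 0]) auto
  then have "\<Union> (interval_antichain n (pseudocomplement n P)) = ?Z"
    using height_pseudocomplement_pos_iff[OF assms(2)]
    by (auto simp: Union_interval_antichain Union_intervals_below)
  moreover have "finite ?Z"
    by (rule finite_subset[of _ "{..n}"]) auto
  \<comment> \<open>Doubling is injective and its values here stay below \<open>2 * n\<close>, so
    the end point adds exactly one element.\<close>
  then have "card (returns P) = card ?Z + 1"
    using assms(1) by (subst returns_eq[OF assms(2,1)]) (auto simp: card_insert_if card_image inj_on_def)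
  ultimately show ?thesis
    by (simp add: antichain_norm_def)
qed

end
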